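(* Let $(G,\sigma)$ be a signed graph of order $n$. Then $$2n-2c(G)\le r(G,\sigma)+2\alpha(G)\le 2n.$$
   Context: All graphs are simple and finite. A signed graph $(G,\sigma)$ consists of a simple graph $G=(V,E)$ (its underlying graph) and a map $\sigma:E\to\{+,-\}$. Its adjacency matrix is $A(G,\sigma)=(a^\sigma_{ij})$ with $a^\sigma_{ij}=\sigma(v_iv_j)a_{ij}$, where $(a_{ij})$ is the ordinary adjacency matrix of $G$ (so entries are $\pm1$ on edges, $0$ otherwise). $r(G,\sigma)$ denotes the rank of $A(G,\sigma)$. $\alpha(G)$ is the independence number of $G$, and $c(G)=|E(G)|-|V(G)|+\omega(G)$ is the cyclomatic number, where $\omega(G)$ is the number of connected components of $G$. *)

theory Defs
  imports "Graph_Theory.Graph_Theory" "Jordan_Normal_Form.DL_Rank"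
begin

text \<open>
  A simple graph is a \<^locale>\<open>graph\<close> of the library: a finite, loop-free, symmetric digraph
  without parallel arcs. An undirected edge is a pair of opposite arcs, represented here by its
  two-element set of endpoints.
\<close>

definition edges :: "('a, 'b) pre_digraph \<Rightarrow> 'a set set" where
  "edges G = {{u, v} | u v. u \<rightarrow>\<^bsub>G\<^esub> v}"

text \<open>Signs are the reals \<open>1\<close> and \<open>-1\<close>; the values of \<open>\<sigma>\<close> outside the edge set are irrelevant.\<close>

locale signed_graph = graph G for G :: "('a, 'b) pre_digraph" (structure) +
  fixes \<sigma> :: "'a set \<Rightarrow> real"
  assumes sign: "e \<in> edges G \<Longrightarrow> \<sigma> e \<in> {1, -1}"

text \<open>The list \<open>vs\<close> is an enumeration of the vertices; entries are indexed from 0.\<close>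

definition signed_adj_mat ::
  "('a, 'b) pre_digraph \<Rightarrow> ('a set \<Rightarrow> real) \<Rightarrow> 'a list \<Rightarrow> real mat" where
  "signed_adj_mat G \<sigma> vs = mat (length vs) (length vs)
     (\<lambda>(i, j). if vs ! i \<rightarrow>\<^bsub>G\<^esub> vs ! j then \<sigma> {vs ! i, vs ! j} else 0)"

definition signed_rank ::
  "('a, 'b) pre_digraph \<Rightarrow> ('a set \<Rightarrow> real) \<Rightarrow> 'a list \<Rightarrow> nat" where
  "signed_rank G \<sigma> vs = vec_space.rank (length vs) (signed_adj_mat G \<sigma> vs)"

definition independent_set :: "('a, 'b) pre_digraph \<Rightarrow> 'a set \<Rightarrow> bool" where
  "independent_set G S \<longleftrightarrow> S \<subseteq> verts G \<and> (\<forall>u\<in>S. \<forall>v\<in>S. \<not> u \<rightarrow>\<^bsub>G\<^esub> v)"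

definition independence_number :: "('a, 'b) pre_digraph \<Rightarrow> nat" where
  "independence_number G = Max (card ` {S. independent_set G S})"

text \<open>
  Since arcs come in opposite pairs, the strongly connected components of a \<^locale>\<open>graph\<close>
  are the connected components of the undirected graph.
\<close>

definition cyclomatic_number :: "('a, 'b) pre_digraph \<Rightarrow> int" where
  "cyclomatic_number G =
     int (card (edges G)) - int (card (verts G)) + int (card (pre_digraph.sccs G))"

end

theory Submission
  imports Defs
begin

text \<open>
  Upper bound: among linearly independent rows, those indexed by an independent set \<open>S\<close> live on
  the \<open>n - card S\<close> columns outside \<open>S\<close>, and at most \<open>n - card S\<close> others remain.
  Lower bound: let \<open>x\<close> be the end of a longest path and induct on the number of vertices.
  If \<open>x\<close> is isolated, delete it and add it to the independent set; if it is pendant at \<open>u\<close>, delete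
  both, gaining two independent rows and one independent vertex; deleting vertices never increases
  the cyclomatic number. Otherwise two neighbours of \<open>x\<close> remain connected without \<open>x\<close>, so
  deleting \<open>x\<close> lowers the cyclomatic number, while neither independent rows nor independent sets
  are lost on adding \<open>x\<close> back.
\<close>

section \<open>Linear independence of rows and columns\<close>

text \<open>Gaussian elimination: each induction step removes one equation and one unknown.\<close>

lemma underdetermined_system:
  fixes f :: "'a \<Rightarrow> 'b \<Rightarrow> 'c::field"
  assumes "finite C" "finite I" "card C < card I"
  shows "\<exists>c. (\<exists>u\<in>I. c u \<noteq> 0) \<and> (\<forall>v\<in>C. (\<Sum>u\<in>I. c u * f u v) = 0)"
  using assms
proof (induction C arbitrary: I f rule: finite_induct)
  case empty
  then have "I \<noteq> {}" by auto
  then show ?case by (intro exI[of _ "\<lambda>_. 1"]) auto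
next
  case (insert v C)
  show ?case
  proof (cases "\<forall>u\<in>I. f u v = 0")
    case True
    obtain c where "\<exists>u\<in>I. c u \<noteq> 0" "\<forall>x\<in>C. (\<Sum>u\<in>I. c u * f u x) = 0"
      using insert.IH[of I f] insert.prems insert.hyps by auto
    then show ?thesis using True by (intro exI[of _ c]) auto
  next
    case False
    then obtain p where p: "p \<in> I" "f p v \<noteq> 0" by blast
    \<comment> \<open>Row \<open>u\<close> minus the multiple of the pivot row \<open>p\<close> that
      clears column \<open>v\<close>.\<close>
    define g where "g u x = f u x - f u v / f p v * f p x" for u x
    have "card C < card (I - {p})" using insert.prems insert.hyps p(1) by simp
    then obtain c where c: "\<exists>u\<in>I - {p}. c u \<noteq> 0" "\<forall>x\<in>C. (\<Sum>u\<in>I - {p}. c u * g u x) = 0"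
      using insert.IH[of "I - {p}" g] insert.prems(1) by blast
    \<comment> \<open>The coefficient at \<open>p\<close> collects the pivot multiples subtracted in
      \<open>g\<close>, so that combining \<open>f\<close> with \<open>d\<close> equals combining
      \<open>g\<close> with \<open>c\<close>.\<close>
    define d where
      "d u = (if u = p then - (\<Sum>u\<in>I - {p}. c u * (f u v / f p v)) else c u)" for u
    have d: "(\<Sum>u\<in>I. d u * f u x) = (\<Sum>u\<in>I - {p}. c u * g u x)" for x
    proof -
      have "(\<Sum>u\<in>I. d u * f u x) = d p * f p x + (\<Sum>u\<in>I - {p}. d u * f u x)"
        using insert.prems p(1) by (simp add: sum.remove)
      also have "(\<Sum>u\<in>I - {p}. d u * f u x) = (\<Sum>u\<in>I - {p}. c u * f u x)"
        by (intro sum.cong) (auto simp: d_def)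
      also have "d p * f p x = - (\<Sum>u\<in>I - {p}. c u * (f u v / f p v) * f p x)"
        by (simp add: d_def sum_distrib_right)
      finally show ?thesis
        by (simp add: g_def right_diff_distrib sum_subtractf mult.assoc)
    qed
    have "g u v = 0" for u using p(2) by (simp add: g_def)
    then have "\<forall>x\<in>insert v C. (\<Sum>u\<in>I. d u * f u x) = 0"
      unfolding d using c(2) by simp
    moreover have "\<exists>u\<in>I. d u \<noteq> 0" using c(1) by (auto simp: d_def)
    ultimately show ?thesis by blast
  qed
qed

text \<open>Independence of an indexed family, so equal rows at two indices are dependent. Rows and
  columns range over arbitrary sets, so deleting vertices only changes these sets.\<close>

definition rows_indep :: "('a \<Rightarrow> 'b \<Rightarrow> 'c::field) \<Rightarrow> 'a set \<Rightarrow> 'b set \<Rightarrow> bool" where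
  "rows_indep w I U \<longleftrightarrow>
     (\<forall>c. (\<forall>v\<in>U. (\<Sum>u\<in>I. c u * w u v) = 0) \<longrightarrow> (\<forall>u\<in>I. c u = 0))"

lemma rows_indepI:
  assumes "\<And>c u. (\<And>v. v \<in> U \<Longrightarrow> (\<Sum>u\<in>I. c u * w u v) = 0) \<Longrightarrow> u \<in> I \<Longrightarrow> c u = 0"
  shows "rows_indep w I U"
  using assms unfolding rows_indep_def by blast

lemma rows_indepD:
  assumes "rows_indep w I U" "\<And>v. v \<in> U \<Longrightarrow> (\<Sum>u\<in>I. c u * w u v) = 0" "u \<in> I"
  shows "c u = 0"
  using assms unfolding rows_indep_def by blast

lemma rows_indep_mono:
  assumes "rows_indep w I U" "U \<subseteq> V"
  shows "rows_indep w I V"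
  using assms unfolding rows_indep_def by blast

lemma rows_indep_subset:
  assumes "rows_indep w I U" "J \<subseteq> I" "finite I"
  shows "rows_indep w J U"
proof (rule rows_indepI)
  fix c u assume c: "\<And>v. v \<in> U \<Longrightarrow> (\<Sum>u\<in>J. c u * w u v) = 0" and u: "u \<in> J"
  define d where "d u = (if u \<in> J then c u else 0)" for u
  have "(\<Sum>u\<in>I. d u * w u v) = (\<Sum>u\<in>J. c u * w u v)" for v
    using assms by (intro sum.mono_neutral_cong_right) (auto simp: d_def)
  then have "d u = 0" using rows_indepD[OF assms(1), of d u] c u assms(2) by auto
  then show "c u = 0" using u by (simp add: d_def)
qed

text \<open>Lets matrix indices be traded for vertices. Repeated rows would be dependent, hence
  \<open>inj_on g J\<close>; repeated columns only repeat equations.\<close>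

lemma rows_indep_reindex:
  assumes "inj_on g J"
  shows "rows_indep w (g ` J) (h ` V) \<longleftrightarrow> rows_indep (\<lambda>i j. w (g i) (h j)) J V"
proof
  assume L: "rows_indep w (g ` J) (h ` V)"
  show "rows_indep (\<lambda>i j. w (g i) (h j)) J V"
  proof (rule rows_indepI)
    fix c j assume c: "\<And>v. v \<in> V \<Longrightarrow> (\<Sum>u\<in>J. c u * w (g u) (h v)) = 0" and j: "j \<in> J"
    have "(\<Sum>u\<in>g ` J. (c \<circ> inv_into J g) u * w u (h v)) = (\<Sum>u\<in>J. c u * w (g u) (h v))" for v
      unfolding sum.reindex[OF assms] using assms by (intro sum.cong) simp_all
    then have "(\<Sum>u\<in>g ` J. (c \<circ> inv_into J g) u * w u v) = 0" if "v \<in> h ` V" for v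
      using that c by fastforce
    from rows_indepD[OF L this, of "g j"] have "(c \<circ> inv_into J g) (g j) = 0" using j by blast
    then show "c j = 0" using assms j by simp
  qed
next
  assume R: "rows_indep (\<lambda>i j. w (g i) (h j)) J V"
  show "rows_indep w (g ` J) (h ` V)"
  proof (rule rows_indepI)
    fix c u assume c: "\<And>v. v \<in> h ` V \<Longrightarrow> (\<Sum>u\<in>g ` J. c u * w u v) = 0" and u: "u \<in> g ` J"
    then obtain j where "j \<in> J" "u = g j" by blast
    moreover have "(\<Sum>u\<in>J. (c \<circ> g) u * w (g u) (h v)) = 0" if "v \<in> V" for v
      using c[of "h v"] that by (simp add: sum.reindex[OF assms])
    from rows_indepD[OF R this \<open>j \<in> J\<close>] have "(c \<circ> g) j = 0" .
    ultimately show "c u = 0" by simp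
  qed
qed

text \<open>With more rows than columns in \<open>C\<close>, some nontrivial combination vanishes on
  \<open>C\<close>, and off \<open>C\<close> every combination vanishes.\<close>

lemma rows_indep_card_le:
  assumes "rows_indep w I U" "finite I" "finite U"
    and "C \<subseteq> U" "\<And>u v. u \<in> I \<Longrightarrow> v \<in> U - C \<Longrightarrow> w u v = 0"
  shows "card I \<le> card C"
proof (rule ccontr)
  assume "\<not> card I \<le> card C"
  then obtain c where c: "\<exists>u\<in>I. c u \<noteq> 0" "\<forall>v\<in>C. (\<Sum>u\<in>I. c u * w u v) = 0"
    using underdetermined_system[of C I w] assms(2) finite_subset[OF assms(4,3)] not_le by blast
  have "(\<Sum>u\<in>I. c u * w u v) = 0" if "v \<in> U" for v
    using c(2) assms(5) that by (cases "v \<in> C") auto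
  then show False using rows_indepD[OF assms(1)] c(1) by blast
qed

text \<open>Passes from an indexed family to the set of column vectors that \<open>rank\<close> is
  about. The columns of \<open>A\<close> play the role of rows in \<open>rows_indep\<close>.\<close>

lemma (in vec_space) card_le_rank:
  assumes A: "A \<in> carrier_mat n nc" and J: "J \<subseteq> {..<nc}"
    and ind: "rows_indep (\<lambda>j i. A $$ (i, j)) J {..<n}"
  shows "card J \<le> rank A"
proof -
  have fin: "finite J" using J finite_subset by blast
  have colidx: "col A j $ i = A $$ (i, j)" if "j \<in> J" "i < n" for i j
    using that A J by auto
  have inj: "inj_on (col A) J"
  proof (rule inj_onI, rule ccontr)
    fix j k assume jk: "j \<in> J" "k \<in> J" "col A j = col A k" "j \<noteq> k"
    \<comment> \<open>Two equal columns would satisfy the relation with coefficients 1 and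
      -1.\<close>
    define c where "c = (\<lambda>i. if i = j then 1 else if i = k then -1 else 0 :: 'a)"
    have "(\<Sum>l\<in>J. c l * A $$ (i, l)) = 0" if i: "i \<in> {..<n}" for i
    proof -
      have "(\<Sum>l\<in>J. c l * A $$ (i, l)) = (\<Sum>l\<in>{j,k}. c l * A $$ (i, l))"
        using fin jk by (intro sum.mono_neutral_right) (auto simp: c_def)
      also have "\<dots> = A $$ (i, j) - A $$ (i, k)"
        using jk(4) by (simp add: c_def)
      also have "\<dots> = 0" using i jk(3) colidx[OF jk(1)] colidx[OF jk(2)] by simp
      finally show ?thesis .
    qed
    from rows_indepD[OF ind this jk(1)] show False by (simp add: c_def)
  qed
  have sub: "col A ` J \<subseteq> set (cols A)"
    using A J by (auto simp: cols_def)
  then have car: "col A ` J \<subseteq> carrier_vec n" using A cols_dim by blast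
  have "lin_indpt (col A ` J)"
  proof
    assume "lin_dep (col A ` J)"
    then obtain a v where a: "lincomb a (col A ` J) = 0\<^sub>v n" "v \<in> col A ` J" "a v \<noteq> 0"
      using finite_lin_dep[OF _ _ car] fin by auto
    have "(\<Sum>j\<in>J. a (col A j) * A $$ (i, j)) = 0" if i: "i \<in> {..<n}" for i
    proof -
      have "(\<Sum>j\<in>J. a (col A j) * A $$ (i, j)) = (\<Sum>x\<in>col A ` J. a x * x $ i)"
        using i by (simp add: sum.reindex[OF inj] colidx)
      also have "\<dots> = lincomb a (col A ` J) $ i"
        using i car by (subst lincomb_index) auto
      finally show ?thesis using a(1) i by simp
    qed
    from rows_indepD[OF ind this] show False using a by auto
  qed
  from rank_ge_card_indpt[OF A sub this] show ?thesis by (simp add: card_image[OF inj])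
qed

text \<open>The rank is the size of a maximal independent set of columns, which only has to be
  indexed.\<close>

lemma (in vec_space) rank_attained:
  assumes A: "A \<in> carrier_mat n nc"
  shows "\<exists>J\<subseteq>{..<nc}. card J = rank A \<and> rows_indep (\<lambda>j i. A $$ (i, j)) J {..<n}"
proof -
  have "lin_indpt {}" by (simp add: lin_dep_def)
  then obtain S where S: "maximal S (\<lambda>T. T \<subseteq> set (cols A) \<and> lin_indpt T)"
    using maximal_exists_superset[of "set (cols A)" "\<lambda>T. T \<subseteq> set (cols A) \<and> lin_indpt T" "{}"]
    by auto
  then have sub: "S \<subseteq> set (cols A)" and li: "lin_indpt S" by (auto simp: maximal_def)
  \<comment> \<open>One index is chosen for each column in \<open>S\<close>, so \<open>J\<close> is
    in bijection with \<open>S\<close> even if \<open>A\<close> repeats columns.\<close>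
  have "set (cols A) = col A ` {..<nc}" using A by (auto simp: cols_def)
  then obtain J where J: "J \<subseteq> {..<nc}" "inj_on (col A) J" "S = col A ` J"
    using sub subset_image_inj by metis
  have car: "S \<subseteq> carrier_vec n" using A cols_dim sub by blast
  have fin: "finite J" using J finite_subset by blast
  have "rows_indep (\<lambda>j i. A $$ (i, j)) J {..<n}"
  proof (rule rows_indepI, rule ccontr)
    fix c j assume c: "\<And>i. i \<in> {..<n} \<Longrightarrow> (\<Sum>j\<in>J. c j * A $$ (i, j)) = 0"
      and j: "j \<in> J" "c j \<noteq> 0"
    define a where "a = c \<circ> inv_into J (col A)"
    have "lincomb a S = 0\<^sub>v n"
    proof (rule eq_vecI)
      fix i assume "i < dim_vec (0\<^sub>v n)"
      then have i: "i < n" by simp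
      have "lincomb a S $ i = (\<Sum>x\<in>S. a x * x $ i)"
        using i car by (rule lincomb_index)
      also have "\<dots> = (\<Sum>j\<in>J. c j * A $$ (i, j))"
        unfolding J(3) sum.reindex[OF J(2)] using i J A
        by (intro sum.cong) (auto simp: a_def)
      finally show "lincomb a S $ i = 0\<^sub>v n $ i" using c i by simp
    qed (use car in \<open>simp add: lincomb_dim fin J(3)\<close>)
    moreover have "a (col A j) \<noteq> 0" using j J by (simp add: a_def)
    ultimately have "lin_dep S"
      using j J(3) fin by (intro lin_dep_crit[where A = S and S = S and a = a and v = "col A j"]) auto
    then show False using li by simp
  qed
  moreover have "card J = rank A"
    using rank_card_indpt[OF A S] J by (simp add: card_image)
  ultimately show ?thesis using J(1) by blast
qed

section \<open>Weighted graphs on a subset of the vertices\<close>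

text \<open>A graph is kept as a symmetric matrix with zero diagonal, its edges being the nonzero
  entries. An induced subgraph is then just a vertex set \<open>U\<close>, and the induction builds
  no new graphs.\<close>

locale weights =
  fixes w :: "'a \<Rightarrow> 'a \<Rightarrow> 'b::field"
  assumes w_sym: "w u v = w v u" and w_diag [simp]: "w u u = 0"
begin

definition adj :: "'a set \<Rightarrow> ('a \<times> 'a) set" where
  "adj U = {(u, v). u \<in> U \<and> v \<in> U \<and> w u v \<noteq> 0}"

definition components :: "'a set \<Rightarrow> 'a set set" where
  "components U = (\<lambda>u. (adj U)\<^sup>* `` {u}) ` U"

definition indep :: "'a set \<Rightarrow> bool" where
  "indep S \<longleftrightarrow> (\<forall>u\<in>S. \<forall>v\<in>S. w u v = 0)"

abbreviation nbrs :: "'a set \<Rightarrow> 'a \<Rightarrow> 'a set" where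
  "nbrs U x \<equiv> {y \<in> U. w x y \<noteq> 0}"

text \<open>This is twice the order minus twice the cyclomatic number, as \<open>adj\<close> contains every edge twice.\<close>

definition excess :: "'a set \<Rightarrow> int" where
  "excess U = 4 * int (card U) - int (card (adj U)) - 2 * int (card (components U))"

lemma not_nbrD:
  assumes "k \<in> U" "k \<notin> nbrs U x"
  shows "w x k = 0" "w k x = 0"
  using assms by (simp_all add: w_sym[of k x])

lemma indep_insert:
  assumes "indep S" "\<And>v. v \<in> S \<Longrightarrow> w x v = 0"
  shows "indep (insert x S)"
  using assms w_sym[of _ x] by (simp add: indep_def)

section \<open>Connectivity and deletion of a vertex\<close>

lemma adj_mono: "U \<subseteq> V \<Longrightarrow> adj U \<subseteq> adj V"
  by (auto simp: adj_def)

lemma finite_adj: "finite U \<Longrightarrow> finite (adj U)"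
  by (rule finite_subset[of _ "U \<times> U"]) (auto simp: adj_def)

lemma adj_rtrancl_sym: "(u, v) \<in> (adj U)\<^sup>* \<Longrightarrow> (v, u) \<in> (adj U)\<^sup>*"
proof -
  have "sym ((adj U)\<^sup>*)" by (rule sym_rtrancl) (auto simp: sym_def adj_def w_sym)
  then show "(u, v) \<in> (adj U)\<^sup>* \<Longrightarrow> (v, u) \<in> (adj U)\<^sup>*" by (rule symD)
qed

lemma adj_rtrancl_in: "(u, v) \<in> (adj U)\<^sup>* \<Longrightarrow> u \<in> U \<Longrightarrow> v \<in> U"
  by (induction rule: rtrancl_induct) (auto simp: adj_def)

lemma component_eq:
  assumes "(u, v) \<in> (adj U)\<^sup>*"
  shows "(adj U)\<^sup>* `` {u} = (adj U)\<^sup>* `` {v}"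
  using assms adj_rtrancl_sym[OF assms] by (auto intro: rtrancl_trans)

text \<open>Each edge at \<open>x\<close> accounts for two ordered pairs, one in each direction,
  which differ because there are no loops.\<close>

lemma card_adj_remove:
  assumes "finite U" "x \<in> U"
  shows "card (adj U) = card (adj (U - {x})) + 2 * card (nbrs U x)"
proof -
  let ?N = "nbrs U x"
  have "adj U = adj (U - {x}) \<union> ({x} \<times> ?N \<union> ?N \<times> {x})"
    using assms(2) by (auto simp: adj_def w_sym)
  moreover have "adj (U - {x}) \<inter> ({x} \<times> ?N \<union> ?N \<times> {x}) = {}"
    by (auto simp: adj_def)
  moreover have "({x} \<times> ?N) \<inter> (?N \<times> {x}) = {}" by auto
  ultimately show ?thesis
    using assms(1) by (simp add: card_Un_disjoint finite_adj card_cartesian_product)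
qed

text \<open>A component of the graph without \<open>x\<close> that contains no neighbour of \<open>x\<close> was already
  a component before; it is distinct from the component of \<open>x\<close>, whence the \<open>+ 1\<close>.\<close>

lemma card_components_remove:
  assumes "finite U" "x \<in> U"
  shows "card (components (U - {x})) + 1 \<le> card (components U) +
           card ((\<lambda>y. (adj (U - {x}))\<^sup>* `` {y}) ` nbrs U x)"
proof -
  let ?U = "U - {x}"
  \<comment> \<open>The components after deletion that contain a neighbour of
    \<open>x\<close>.\<close>
  let ?Q = "(\<lambda>y. (adj ?U)\<^sup>* `` {y}) ` nbrs U x"
  let ?X = "(adj U)\<^sup>* `` {x}"
  have "components ?U \<subseteq> (components U - {?X}) \<union> ?Q"
  proof
    fix C assume "C \<in> components ?U"
    then obtain y where y: "y \<in> ?U" "C = (adj ?U)\<^sup>* `` {y}" by (auto simp: components_def)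
    show "C \<in> (components U - {?X}) \<union> ?Q"
    proof (cases "\<exists>z\<in>C. w x z \<noteq> 0")
      case True
      then obtain z where z: "(y, z) \<in> (adj ?U)\<^sup>*" "w x z \<noteq> 0" using y by auto
      then have "z \<in> U" using adj_rtrancl_in[OF z(1)] y by auto
      moreover have "C = (adj ?U)\<^sup>* `` {z}" using component_eq[OF z(1)] y by simp
      ultimately have "C \<in> ?Q" using z(2) by blast
      then show ?thesis ..
    next
      case False
      \<comment> \<open>A path from \<open>y\<close> cannot enter \<open>x\<close>: the vertex
        before \<open>x\<close> would be a neighbour of \<open>x\<close> in
        \<open>C\<close>.\<close>
      have closed: "(y, z) \<in> (adj ?U)\<^sup>*" if "(y, z) \<in> (adj U)\<^sup>*" for z
        using that
      proof (induction rule: rtrancl_induct)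
        case (step u v)
        have "u \<in> ?U" using adj_rtrancl_in[OF step.IH] y(1) by simp
        moreover have "v \<noteq> x" using False step.IH step.hyps(2) y(2) w_sym
          by (auto simp: adj_def)
        ultimately have "(u, v) \<in> adj ?U" using step.hyps by (auto simp: adj_def)
        with step.IH show ?case by simp
      qed simp
      have "(adj ?U)\<^sup>* \<subseteq> (adj U)\<^sup>*" by (intro rtrancl_mono adj_mono) auto
      then have "C = (adj U)\<^sup>* `` {y}" using closed y(2) by auto
      moreover have "x \<notin> C" using adj_rtrancl_in[of y x ?U] y by auto
      ultimately show ?thesis using y(1) by (auto simp: components_def)
    qed
  qed
  then have "card (components ?U) \<le> card ((components U - {?X}) \<union> ?Q)"
    using assms(1) by (intro card_mono) (auto simp: components_def)
  also have "\<dots> \<le> card (components U - {?X}) + card ?Q" by (rule card_Un_le)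
  finally have 1: "card (components ?U) \<le> card (components U - {?X}) + card ?Q" .
  have "finite (components U)" "?X \<in> components U"
    using assms by (auto simp: components_def)
  then have "card (components U - {?X}) + 1 = card (components U)"
    using card_Suc_Diff1 by fastforce
  with 1 show ?thesis by simp
qed

text \<open>The vertex itself contributes 4, each of its edges -2, and the components at most
  \<open>2 * (q - 1)\<close>, where \<open>q\<close> counts the components met by its neighbours
  after deletion.\<close>

lemma excess_remove:
  assumes "finite U" "x \<in> U"
  shows "excess U \<le> excess (U - {x}) + 2 - 2 * int (card (nbrs U x)) +
           2 * int (card ((\<lambda>y. (adj (U - {x}))\<^sup>* `` {y}) ` nbrs U x))"
proof -
  have "card U = card (U - {x}) + 1" using assms card_Suc_Diff1 by fastforce
  then show ?thesis
    using card_adj_remove[OF assms] card_components_remove[OF assms]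
    unfolding excess_def by linarith
qed

text \<open>Here \<open>q\<close> is at most the degree. In terms of the cyclomatic number: deleting
  a vertex does not increase it.\<close>

lemma excess_remove_le:
  assumes "finite U" "x \<in> U"
  shows "excess U \<le> excess (U - {x}) + 2"
proof -
  have "card ((\<lambda>y. (adj (U - {x}))\<^sup>* `` {y}) ` nbrs U x) \<le> card (nbrs U x)"
    using assms by (intro card_image_le) auto
  then show ?thesis using excess_remove[OF assms] by linarith
qed

text \<open>Two neighbours share a component, so \<open>q\<close> is at most the degree minus 1: the
  cyclomatic number drops by at least 1, which offsets the lost vertex.\<close>

lemma excess_remove_linked:
  assumes "finite U" "x \<in> U" and "y \<in> nbrs U x" "z \<in> nbrs U x" "y \<noteq> z"
    and "(y, z) \<in> (adj (U - {x}))\<^sup>*"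
  shows "excess U \<le> excess (U - {x})"
proof -
  let ?f = "\<lambda>y. (adj (U - {x}))\<^sup>* `` {y}"
  have "?f ` nbrs U x = ?f ` (nbrs U x - {y})"
    using component_eq[OF assms(6)] assms(3-5) by blast
  also have "card \<dots> \<le> card (nbrs U x - {y})" using assms(1) by (intro card_image_le) auto
  also have "\<dots> + 1 = card (nbrs U x)"
    using assms(1,3) card_Suc_Diff1[of "nbrs U x" y] by simp
  finally have "card (?f ` nbrs U x) + 1 \<le> card (nbrs U x)" by simp
  then show ?thesis using excess_remove[OF assms(1,2)] by linarith
qed

lemma path_linked:
  assumes "successively (\<lambda>u v. w u v \<noteq> 0) p" "set p \<subseteq> U" "y \<in> set p" "z \<in> set p"
  shows "(y, z) \<in> (adj U)\<^sup>*"
proof -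
  have "\<forall>v\<in>set p. (hd p, v) \<in> (adj U)\<^sup>*" using assms(1,2)
  proof (induction p)
    case (Cons a p)
    show ?case
    proof (cases p)
      case (Cons b q)
      then have "(a, b) \<in> adj U" "\<forall>v\<in>set p. (b, v) \<in> (adj U)\<^sup>*"
        using Cons.IH Cons.prems by (auto simp: adj_def)
      then show ?thesis by (auto intro: converse_rtrancl_into_rtrancl)
    qed simp
  qed simp
  then show ?thesis using assms(3,4) adj_rtrancl_sym rtrancl_trans by metis
qed

text \<open>The end of a longest path: all its neighbours lie on the path.\<close>

lemma ex_vertex_nbrs_linked:
  assumes "finite U" "U \<noteq> {}"
  obtains x where "x \<in> U"
    "\<forall>y\<in>nbrs U x. \<forall>z\<in>nbrs U x. (y, z) \<in> (adj (U - {x}))\<^sup>*"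
proof -
  define P where "P = (\<lambda>p. p \<noteq> [] \<and> distinct p \<and> set p \<subseteq> U \<and> successively (\<lambda>u v. w u v \<noteq> 0) p)"
  obtain u where "u \<in> U" using assms(2) by blast
  then have "P [u]" by (simp add: P_def)
  \<comment> \<open>Distinctness bounds the length by \<open>card U\<close>; the \<open>+ 1\<close>
    makes the bound strict, so a longest path exists.\<close>
  moreover have "\<forall>p. P p \<longrightarrow> length p < card U + 1"
    using assms(1) by (auto simp: P_def less_Suc_eq_le card_mono simp flip: distinct_card)
  ultimately obtain p where p: "P p" "\<And>q. P q \<Longrightarrow> length q \<le> length p"
    using ex_has_greatest_nat[of P "[u]" length "card U + 1"] by auto
  then obtain x q where pq: "p = x # q" by (cases p) (auto simp: P_def)
  have x: "x \<in> U" "x \<notin> set q" "set q \<subseteq> U - {x}" using p(1) pq by (auto simp: P_def)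
  \<comment> \<open>A neighbour off the path could be put in front of \<open>p\<close>, making it
    longer.\<close>
  have nbr: "y \<in> set q" if "y \<in> nbrs U x" for y
  proof (rule ccontr)
    assume "y \<notin> set q"
    moreover have "y \<noteq> x" "w y x \<noteq> 0" using that w_sym by auto
    ultimately have "P (y # p)" using p(1) pq that by (auto simp: P_def)
    then show False using p(2)[of "y # p"] by simp
  qed
  \<comment> \<open>The rest \<open>q\<close> of the path avoids \<open>x\<close> and contains all
    its neighbours, hence links them in \<open>U - {x}\<close>.\<close>
  have "successively (\<lambda>u v. w u v \<noteq> 0) q"
    using p(1) pq by (cases q) (auto simp: P_def)
  then show thesis using that[of x] x nbr path_linked by blast
qed

text \<open>Row \<open>x\<close> is nonzero only in column \<open>u\<close>, and column
  \<open>x\<close> only in row \<open>u\<close>. Hence column \<open>x\<close> forces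
  \<open>c u = 0\<close>, the columns of \<open>U - {x, u}\<close> then kill the coefficients on
  \<open>I\<close>, and finally column \<open>u\<close> forces \<open>c x = 0\<close>.\<close>

lemma rows_indep_pendant:
  assumes "rows_indep w I (U - {x, u})" "I \<subseteq> U - {x, u}" "finite U"
    and "x \<in> U" "nbrs U x = {u}"
  shows "rows_indep w (insert x (insert u I)) U"
proof (rule rows_indepI)
  fix c k assume c: "\<And>v. v \<in> U \<Longrightarrow> (\<Sum>k\<in>insert x (insert u I). c k * w k v) = 0" and k: "k \<in> insert x (insert u I)"
  have u: "u \<in> U" "w x u \<noteq> 0" "w u x \<noteq> 0" using assms(5) w_sym by auto
  then have "u \<noteq> x" by auto
  have wx: "w k x = 0" "w x k = 0" if "k \<in> U" "k \<noteq> u" for k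
    using not_nbrD[of k U x] that unfolding assms(5) by simp_all
  have fin: "finite I" using assms finite_subset by blast
  have sum: "(\<Sum>k\<in>insert x (insert u I). c k * w k v) = c x * w x v + (c u * w u v + (\<Sum>k\<in>I. c k * w k v))" for v
  proof -
    have "x \<notin> I" "u \<notin> I" using assms(2) by auto
    then show ?thesis using fin \<open>u \<noteq> x\<close> by simp
  qed
  have "(\<Sum>k\<in>I. c k * w k x) = 0"
    using assms(2) wx by (intro sum.neutral) auto
  then have cu: "c u = 0" using c[OF assms(4)] u by (simp add: sum)
  have "(\<Sum>k\<in>I. c k * w k v) = 0" if "v \<in> U - {x, u}" for v
    using c[of v] that wx[of v] cu by (simp add: sum)
  then have cI: "c k = 0" if "k \<in> I" for k
    using rows_indepD[OF assms(1)] that by blast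
  then have "c x = 0" using c[of u] u by (simp add: sum)
  with cu cI k show "c k = 0" by auto
qed

text \<open>Explicit witnesses \<open>I\<close> and \<open>S\<close> replace rank and independence
  number, so that the sets obtained for a smaller graph can be extended.\<close>

theorem excess_le:
  assumes "finite U"
  shows "\<exists>I S. I \<subseteq> U \<and> S \<subseteq> U \<and> rows_indep w I U \<and> indep S \<and>
           excess U \<le> int (card I) + 2 * int (card S)"
  using assms
proof (induction U rule: finite_psubset_induct)
  case (psubset U)
  show ?case
  proof (cases "U = {}")
    case True
    then show ?thesis
      by (auto simp: rows_indep_def indep_def excess_def adj_def components_def)
  next
    case False
    obtain x where x: "x \<in> U"
      "\<forall>y\<in>nbrs U x. \<forall>z\<in>nbrs U x. (y, z) \<in> (adj (U - {x}))\<^sup>*"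
      using ex_vertex_nbrs_linked[OF psubset.hyps False] .
    consider "nbrs U x = {}" | u where "nbrs U x = {u}"
      | y z where "y \<in> nbrs U x" "z \<in> nbrs U x" "y \<noteq> z"
      by blast
    then show ?thesis
    proof cases
      \<comment> \<open>The excess grows by at most 2, paid for by adding \<open>x\<close> to
        \<open>S\<close>, which counts twice.\<close>
      case 1
      obtain I S where IS: "I \<subseteq> U - {x}" "S \<subseteq> U - {x}" "rows_indep w I (U - {x})" "indep S"
        "excess (U - {x}) \<le> int (card I) + 2 * int (card S)"
        using psubset.IH[of "U - {x}"] x(1) by blast
      have "indep (insert x S)" using IS(2,4) 1 by (intro indep_insert) auto
      moreover have "card (insert x S) = card S + 1"
        using IS(2) finite_subset[OF IS(2)] psubset.hyps by (subst card_insert_disjoint) auto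
      moreover have "rows_indep w I U" using rows_indep_mono[OF IS(3)] by blast
      ultimately show ?thesis
        using IS x(1) excess_remove_le[OF psubset.hyps x(1)]
        by (intro exI[of _ I] exI[of _ "insert x S"]) auto
    next
      \<comment> \<open>The excess grows by at most 4: the new rows \<open>x\<close> and
        \<open>u\<close> pay 2, and \<open>x\<close> in \<open>S\<close> pays the other 2. The only
        neighbour \<open>u\<close> of \<open>x\<close> lies outside \<open>S\<close>.\<close>
      case 2
      have u: "u \<in> U" "u \<noteq> x" using 2 by auto
      have eq: "U - {u} - {x} = U - {x, u}" by auto
      obtain I S where IS: "I \<subseteq> U - {x, u}" "S \<subseteq> U - {x, u}" "rows_indep w I (U - {x, u})"
        "indep S" "excess (U - {x, u}) \<le> int (card I) + 2 * int (card S)"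
        using psubset.IH[of "U - {x, u}"] x(1) by blast
      have fin: "finite I" "finite S" using IS psubset.hyps finite_subset by blast+
      have "indep (insert x S)" using IS(2,4) 2 by (intro indep_insert) auto
      moreover have "card (insert x S) = card S + 1"
        using IS fin by (subst card_insert_disjoint) auto
      moreover have "card (insert x (insert u I)) = card I + 2"
        using IS(1) fin u by (subst card_insert_disjoint, auto)+
      moreover have "rows_indep w (insert x (insert u I)) U"
        using rows_indep_pendant[OF IS(3,1) psubset.hyps x(1) 2] .
      moreover have "excess U \<le> excess (U - {x, u}) + 4"
        using excess_remove_le[OF psubset.hyps u(1)] excess_remove_le[of "U - {u}" x]
          psubset.hyps x(1) u(2) by (simp add: eq)
      ultimately show ?thesis
        using IS x(1) u(1) by (intro exI[of _ "insert x (insert u I)"] exI[of _ "insert x S"]) auto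
    next
      \<comment> \<open>The excess does not grow, so \<open>I\<close> and \<open>S\<close> serve
        unchanged.\<close>
      case 3
      obtain I S where IS: "I \<subseteq> U - {x}" "S \<subseteq> U - {x}" "rows_indep w I (U - {x})" "indep S"
        "excess (U - {x}) \<le> int (card I) + 2 * int (card S)"
        using psubset.IH[of "U - {x}"] x(1) by blast
      have "excess U \<le> excess (U - {x})"
        using excess_remove_linked[OF psubset.hyps x(1) 3] x(2) 3(1,2) by blast
      moreover have "rows_indep w I U" using rows_indep_mono[OF IS(3)] by blast
      ultimately show ?thesis using IS by (intro exI[of _ I] exI[of _ S]) auto
    qed
  qed
qed

text \<open>The rows in \<open>S\<close> vanish outside the columns of \<open>U - S\<close>.\<close>

theorem card_rows_indep_le:
  assumes "finite U" "I \<subseteq> U" "S \<subseteq> U" "rows_indep w I U" "indep S"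
  shows "card I + 2 * card S \<le> 2 * card U"
proof -
  have fin: "finite I" "finite S" using assms finite_subset by blast+
  have "card (I \<inter> S) \<le> card (U - S)"
    using assms fin rows_indep_subset[OF assms(4), of "I \<inter> S"]
    by (intro rows_indep_card_le[where w = w and U = U]) (auto simp: indep_def)
  moreover have "card (I - S) \<le> card (U - S)"
    using assms by (intro card_mono) auto
  moreover have "card I = card (I \<inter> S) + card (I - S)"
    using fin by (metis card_Int_Diff)
  moreover have "card (U - S) + card S = card U"
    using assms fin by (metis card_Diff_subset card_mono le_add_diff_inverse2)
  ultimately show ?thesis by simp
qed

end

section \<open>Signed graphs\<close>

context signed_graph
begin

definition weight :: "'a \<Rightarrow> 'a \<Rightarrow> real" where
  "weight u v = (if u \<rightarrow> v then \<sigma> {u, v} else 0)"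

lemma weight_nonzero_iff: "weight u v \<noteq> 0 \<longleftrightarrow> u \<rightarrow> v"
proof -
  have "\<sigma> {u, v} \<in> {1, -1}" if "u \<rightarrow> v" using that by (intro sign) (auto simp: edges_def)
  then show ?thesis by (auto simp: weight_def)
qed

sublocale weights weight
proof
  show "weight u v = weight v u" for u v
    by (auto simp: weight_def insert_commute dest: graph_symmetric)
  show "weight u u = 0" for u
    using adj_not_same weight_nonzero_iff by metis
qed

section \<open>Edges, components and independent sets of a signed graph\<close>

lemma adj_verts: "adj (verts G) = arcs_ends G"
  by (auto simp: adj_def weight_nonzero_iff dest: adj_in_verts)

text \<open>Reachability is mutual in a symmetric digraph, so its classes are the strongly connected
  components.\<close>

lemma card_components_verts: "card (components (verts G)) = card sccs"
proof -
  \<comment> \<open>The relation \<open>\<rightarrow>\<^sup>*\<close> also demands that the walk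
    stay inside \<open>verts G\<close>, which is automatic from a vertex of
    \<open>G\<close>.\<close>
  have reach: "(u, v) \<in> (arcs_ends G)\<^sup>* \<longleftrightarrow> u \<rightarrow>\<^sup>* v" if "u \<in> verts G" for u v
    using that reachable_rtranclI[of G u v] rtrancl_consistent_rtrancl_on[of u v "arcs_ends G" "verts G"]
      adj_rtrancl_in[of u v "verts G"] adj_in_verts
    by (auto simp: reachable_def adj_verts)
  have scc: "scc_of u = (arcs_ends G)\<^sup>* `` {u}" if "u \<in> verts G" for u
    using reach[OF that] symmetric_reachable[OF sym_arcs] by (auto simp: scc_of_def)
  have "components (verts G) = scc_of ` verts G"
    by (auto simp: components_def adj_verts scc)
  also have "\<dots> = sccs_verts"
  proof (intro equalityI subsetI)
    fix C assume C: "C \<in> sccs_verts"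
    then obtain u where u: "u \<in> C" by (auto simp: sccs_verts_def)
    have "C = scc_of u"
      using C u unfolding sccs_verts_def scc_of_def by blast
    then show "C \<in> scc_of ` verts G" using C u sccs_verts_subsets by blast
  qed (use scc_of_in_sccs_verts in auto)
  finally show ?thesis by (simp add: card_sccs_verts)
qed

text \<open>The ordered pairs are grouped by their underlying edge; without loops each group has
  exactly two members.\<close>

lemma card_arcs_ends: "card (arcs_ends G) = 2 * card (edges G)"
proof -
  have edges: "edges G = (\<lambda>(u, v). {u, v}) ` arcs_ends G"
    by (auto simp: edges_def)
  have "arcs_ends G = (\<Union>e\<in>edges G. {(u, v). {u, v} = e})"
    by (auto simp: edges_def doubleton_eq_iff dest: graph_symmetric)
  also have "card \<dots> = (\<Sum>e\<in>edges G. card {(u, v). {u, v} = e})"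
  proof (rule card_UN_disjoint)
    show "finite (edges G)" 
      using finite_adj[OF finite_verts] by (simp add: edges adj_verts)
    have "{(u, v). {u, v} = {a, b}} = {(a, b), (b, a)}" for a b :: 'a
      by (auto simp: doubleton_eq_iff)
    then show "\<forall>e\<in>edges G. finite {(u, v). {u, v} = e}" by (auto simp: edges_def)
  qed auto
  also have "\<dots> = (\<Sum>e\<in>edges G. 2)"
  proof (rule sum.cong)
    fix e assume "e \<in> edges G"
    then obtain a b where e: "e = {a, b}" "a \<rightarrow> b" by (auto simp: edges_def)
    then have "{(u, v). {u, v} = e} = {(a, b), (b, a)}" "a \<noteq> b"
      using adj_not_same by (auto simp: doubleton_eq_iff)
    then show "card {(u, v). {u, v} = e} = 2" by simp
  qed simp
  finally show ?thesis by simp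
qed

text \<open>With m edges and k components, 4 n - 2 m - 2 k = 2 n - 2 (m - n + k).\<close>

lemma excess_verts:
  "excess (verts G) = 2 * int (card (verts G)) - 2 * cyclomatic_number G"
  by (simp add: excess_def adj_verts card_arcs_ends card_components_verts cyclomatic_number_def)

lemma independent_set_iff: "independent_set G S \<longleftrightarrow> S \<subseteq> verts G \<and> indep S"
  unfolding independent_set_def indep_def using weight_nonzero_iff by blast

lemma finite_independent_sets: "finite {S. independent_set G S}"
  by (rule finite_subset[of _ "Pow (verts G)"]) (auto simp: independent_set_def)

lemma card_le_independence_number:
  assumes "S \<subseteq> verts G" "indep S"
  shows "card S \<le> independence_number G"
  unfolding independence_number_def using assms independent_set_iff
  by (intro Max_ge finite_imageI finite_independent_sets) auto

lemma independence_number_attained: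
  "\<exists>S\<subseteq>verts G. indep S \<and> card S = independence_number G"
proof -
  have "independent_set G {}" by (simp add: independent_set_def)
  then have "independence_number G \<in> card ` {S. independent_set G S}"
    unfolding independence_number_def using finite_independent_sets by (intro Max_in) auto
  then show ?thesis using independent_set_iff by auto
qed

section \<open>The signed adjacency matrix and its rank\<close>

context
  fixes vs :: "'a list"
  assumes vs: "distinct vs" "set vs = verts G"
begin

text \<open>By symmetry, column \<open>j\<close> of the matrix is the row of \<open>weight\<close>
  at the vertex \<open>vs ! j\<close>.\<close>

lemma rows_indep_verts_iff:
  assumes "J \<subseteq> {..<length vs}"
  shows "rows_indep (\<lambda>j i. signed_adj_mat G \<sigma> vs $$ (i, j)) J {..<length vs} \<longleftrightarrow>
           rows_indep weight ((!) vs ` J) (verts G)"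
proof -
  have inj: "inj_on ((!) vs) J" using vs(1) assms by (intro inj_on_nth) auto
  have "verts G = (!) vs ` {..<length vs}" unfolding vs(2)[symmetric]
    by (auto simp: set_conv_nth)
  then have "rows_indep weight ((!) vs ` J) (verts G) \<longleftrightarrow>
      rows_indep (\<lambda>j i. weight (vs ! j) (vs ! i)) J {..<length vs}"
    using rows_indep_reindex[OF inj] by simp
  moreover have "signed_adj_mat G \<sigma> vs $$ (i, j) = weight (vs ! j) (vs ! i)"
    if "i < length vs" "j < length vs" for i j
    using that w_sym[of "vs ! j" "vs ! i"] by (simp add: signed_adj_mat_def weight_def)
  then have "(\<Sum>j\<in>J. c j * signed_adj_mat G \<sigma> vs $$ (i, j)) =
      (\<Sum>j\<in>J. c j * weight (vs ! j) (vs ! i))" if "i < length vs" for c i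
    using that assms by (intro sum.cong) auto
  ultimately show ?thesis by (simp add: rows_indep_def)
qed

lemma card_le_signed_rank:
  assumes "I \<subseteq> verts G" "rows_indep weight I (verts G)"
  shows "card I \<le> signed_rank G \<sigma> vs"
proof -
  have "verts G = (!) vs ` {..<length vs}" unfolding vs(2)[symmetric]
    by (auto simp: set_conv_nth)
  then obtain J where J: "J \<subseteq> {..<length vs}" "inj_on ((!) vs) J" "I = (!) vs ` J"
    using assms(1) subset_image_inj by metis
  have "card J \<le> signed_rank G \<sigma> vs" unfolding signed_rank_def
    using J assms(2) rows_indep_verts_iff[OF J(1)]
    by (intro vec_space.card_le_rank[where nc = "length vs"]) (auto simp: signed_adj_mat_def)
  then show ?thesis using J by (simp add: card_image)
qed

lemma signed_rank_attained:
  "\<exists>I\<subseteq>verts G. rows_indep weight I (verts G) \<and> card I = signed_rank G \<sigma> vs"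
proof -
  have "signed_adj_mat G \<sigma> vs \<in> carrier_mat (length vs) (length vs)"
    by (simp add: signed_adj_mat_def)
  from vec_space.rank_attained[OF this] obtain J where J: "J \<subseteq> {..<length vs}"
    "card J = signed_rank G \<sigma> vs"
    "rows_indep (\<lambda>j i. signed_adj_mat G \<sigma> vs $$ (i, j)) J {..<length vs}"
    unfolding signed_rank_def by blast
  have "inj_on ((!) vs) J" using vs(1) J(1) by (intro inj_on_nth) auto
  moreover have "(!) vs ` J \<subseteq> verts G" using J(1) vs(2) nth_mem by blast
  ultimately show ?thesis
    using J rows_indep_verts_iff[OF J(1)] by (auto simp: card_image)
qed

end

end

theorem theorem1p1:
  fixes G :: "('a, 'b) pre_digraph" and \<sigma> :: "'a set \<Rightarrow> real" and vs :: "'a list" and n :: nat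
  assumes "signed_graph G \<sigma>"
    and "card (verts G) = n"
    and "distinct vs" and "set vs = verts G"
  shows "2 * int n - 2 * cyclomatic_number G
           \<le> int (signed_rank G \<sigma> vs) + 2 * int (independence_number G)
       \<and> int (signed_rank G \<sigma> vs) + 2 * int (independence_number G) \<le> 2 * int n"
proof -
  interpret signed_graph G \<sigma> by fact
  obtain I S where IS: "I \<subseteq> verts G" "S \<subseteq> verts G" "rows_indep weight I (verts G)" "indep S"
    "excess (verts G) \<le> int (card I) + 2 * int (card S)"
    using excess_le[OF finite_verts] by blast
  have "card I \<le> signed_rank G \<sigma> vs" "card S \<le> independence_number G"
    using card_le_signed_rank[OF assms(3,4)] card_le_independence_number IS by blast+
  then have lower: "2 * int n - 2 * cyclomatic_number G
      \<le> int (signed_rank G \<sigma> vs) + 2 * int (independence_number G)"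
    using IS(5) excess_verts assms(2) by linarith
  \<comment> \<open>The lower bound needed only some sets \<open>I\<close> and \<open>S\<close>; the
    upper bound needs sets attaining both numbers.\<close>
  obtain I' S' where "I' \<subseteq> verts G" "rows_indep weight I' (verts G)" "card I' = signed_rank G \<sigma> vs"
    "S' \<subseteq> verts G" "indep S'" "card S' = independence_number G"
    using signed_rank_attained[OF assms(3,4)] independence_number_attained by blast
  then have "signed_rank G \<sigma> vs + 2 * independence_number G \<le> 2 * n"
    using card_rows_indep_le[OF finite_verts, of I' S'] assms(2) by simp
  then show ?thesis using lower by linarith
qed

end
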